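(* Let $K$ be a field, $n\geq 1$, and let $m\geq 2$ be an integer with $m\notin \mathrm{char}\,K\cdot\mathbb{Z}$. Let $\varphi\in G_\infty(n,K)$ be an $m$-periodic series with $\varphi_1$ diagonalizable (as a matrix in $GL_n(K)$, over $K$). Then $\varphi$ is conjugate to $\varphi_1$, i.e. there exists $\phi\in G_\infty(n,K)$ such that $\varphi=\phi^{-1}\varphi_1\phi$.
   Context: Every $\varphi\in K[[x_1,\dots,x_n]]^n$ has a unique homogeneous decomposition $\varphi=\sum_{k=0}^\infty\varphi_k$, where $\varphi_k$ is an $n$-tuple of homogeneous polynomials of degree $k$. $G_\infty(n,K)$ is the set of all $\varphi\in K[[x_1,\dots,x_n]]^n$ with $\varphi_0=0$ and $\varphi_1\in GL_n(K)$ (an $n$-tuple of linear forms $\left(\sum_j a_{1j}x_j,\dots,\sum_j a_{nj}x_j\right)$ is identified with the matrix $(a_{ij})$). It is a group under composition $\varphi\phi=\varphi\circ\phi=(f_1(\phi),\dots,f_n(\phi))$ for $\varphi=(f_1,\dots,f_n)$, with identity $id=(x_1,\dots,x_n)$; $\phi^{-1}$ denotes the inverse in this group. A series is $m$-periodic if its order in the group $G_\infty(n,K)$ equals $m$. *)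

theory Defs
  imports "HOL-Analysis.Determinants" "HOL-Algebra.Multiplicative_Group"
begin

subsection \<open>Formal power series in several variables\<close>

text \<open>
  The variables are indexed by a finite type \<open>'n\<close>, so that \<open>n = CARD('n)\<close>; an exponent is an
  arbitrary function \<open>a :: 'n \<Rightarrow> nat\<close>, standing for the monomial \<open>\<Prod>i. x\<^sub>i ^ a i\<close>.
  Exponents are compared and subtracted pointwise.
\<close>

typedef ('a, 'n) mfps = "UNIV :: (('n::finite \<Rightarrow> nat) \<Rightarrow> 'a) set"
  morphisms mfps_coeff Abs_mfps
  by simp

lemma mfps_coeff_Abs [simp]: "mfps_coeff (Abs_mfps f) = f"
  by (simp add: Abs_mfps_inverse)

lemma mfps_eq_iff: "f = g \<longleftrightarrow> (\<forall>e. mfps_coeff f e = mfps_coeff g e)"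
  by (metis ext mfps_coeff_inject)

definition mdeg :: "('n::finite \<Rightarrow> nat) \<Rightarrow> nat" where
  "mdeg a = (\<Sum>i\<in>UNIV. a i)"

lemma finite_exponents_atMost [simp]: "finite {..e :: 'n::finite \<Rightarrow> nat}"
proof (rule finite_subset)
  show "{..e} \<subseteq> (\<Pi>\<^sub>E i\<in>UNIV. {..e i})"
    by (auto simp: le_fun_def)
  show "finite (\<Pi>\<^sub>E i\<in>UNIV. {..e i})"
    by (rule finite_PiE) auto
qed

lemma finite_mdeg_le [simp]: "finite {a :: 'n::finite \<Rightarrow> nat. mdeg a \<le> d}"
proof (rule finite_subset)
  show "{a :: 'n \<Rightarrow> nat. mdeg a \<le> d} \<subseteq> {..\<lambda>_. d}"
  proof clarsimp
    fix a :: "'n \<Rightarrow> nat"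
    assume d: "mdeg a \<le> d"
    have "a i \<le> d" for i
      using member_le_sum[of i UNIV a] d by (simp add: mdeg_def)
    then show "a \<le> (\<lambda>_. d)"
      by (simp add: le_fun_def)
  qed
qed simp

instantiation mfps :: (comm_ring_1, finite) comm_ring_1
begin

definition "0 = Abs_mfps (\<lambda>_. 0)"
definition "1 = Abs_mfps (\<lambda>e. if e = (\<lambda>_. 0) then 1 else 0)"
definition "f + g = Abs_mfps (\<lambda>e. mfps_coeff f e + mfps_coeff g e)"
definition "f - g = Abs_mfps (\<lambda>e. mfps_coeff f e - mfps_coeff g e)"
definition "- f = Abs_mfps (\<lambda>e. - mfps_coeff f e)"
definition "f * g = Abs_mfps (\<lambda>e. \<Sum>a\<le>e. mfps_coeff f a * mfps_coeff g (e - a))"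

instance
proof
  fix f g h :: "('a, 'b) mfps"
  show "f * g * h = f * (g * h)"
    unfolding mfps_eq_iff
  proof
    fix e :: "'b \<Rightarrow> nat"
    let ?S = "Sigma {..e} (\<lambda>a. {..a})" and ?T = "Sigma {..e} (\<lambda>b. {..e - b})"
    have "mfps_coeff (f * g * h) e =
        (\<Sum>(a,b)\<in>?S. mfps_coeff f b * mfps_coeff g (a - b) * mfps_coeff h (e - a))"
      by (simp add: times_mfps_def sum_distrib_right sum.Sigma)
    also have "\<dots> = (\<Sum>(b,c)\<in>?T. mfps_coeff f b * (mfps_coeff g c * mfps_coeff h (e - b - c)))"
      by (rule sum.reindex_bij_witness
            [where i = "\<lambda>(b,c). (\<lambda>i. b i + c i, b)" and j = "\<lambda>(a,b). (b, a - b)"])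
         (auto simp: le_fun_def fun_eq_iff mult.assoc fun_diff_def diff_le_mono
            intro: order_trans add_le_imp_le_diff
              arg_cong2[where f = "(*)"] arg_cong[where f = "mfps_coeff g"]
              arg_cong[where f = "mfps_coeff h"],
          (metis le_diff_conv2 add.commute order_trans)+)
    also have "\<dots> = mfps_coeff (f * (g * h)) e"
      by (simp add: times_mfps_def sum_distrib_left sum.Sigma)
    finally show "mfps_coeff (f * g * h) e = mfps_coeff (f * (g * h)) e" .
  qed
  show "f * g = g * f"
    unfolding mfps_eq_iff
  proof
    fix e :: "'b \<Rightarrow> nat"
    show "mfps_coeff (f * g) e = mfps_coeff (g * f) e"
      unfolding times_mfps_def mfps_coeff_Abs
      by (rule sum.reindex_bij_witness[where i = "\<lambda>a. e - a" and j = "\<lambda>a. e - a"])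
         (auto simp: le_fun_def fun_diff_def mult.commute)
  qed
  show "1 * f = f"
    unfolding mfps_eq_iff
  proof
    fix e :: "'b \<Rightarrow> nat"
    have "mfps_coeff (1 * f) e =
        (\<Sum>a\<le>e. if a = (\<lambda>_. 0) then mfps_coeff f e else 0)"
      unfolding times_mfps_def one_mfps_def mfps_coeff_Abs
      by (rule sum.cong) (auto simp: fun_diff_def)
    then show "mfps_coeff (1 * f) e = mfps_coeff f e"
      by (simp add: le_fun_def)
  qed
  show "(0 :: ('a, 'b) mfps) \<noteq> 1"
    by (auto simp: mfps_eq_iff zero_mfps_def one_mfps_def)
qed (auto simp: mfps_eq_iff zero_mfps_def plus_mfps_def minus_mfps_def uminus_mfps_def
       times_mfps_def algebra_simps sum.distrib)

end

definition mfps_var :: "'n::finite \<Rightarrow> ('a::comm_ring_1, 'n) mfps" where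
  "mfps_var j = Abs_mfps (\<lambda>e. if e = (\<lambda>k. if k = j then 1 else 0) then 1 else 0)"

subsection \<open>Composition\<close>

text \<open>
  The coefficient of \<open>f(\<phi>)\<close> at \<open>e\<close> is cut off at exponents \<open>a\<close> of total degree at most
  that of \<open>e\<close>.  When \<open>\<phi>\<close> has no constant terms, which is the only case in which it is used
  below, all other exponents contribute zero (\<open>mfps_coeff_compose\<close>).
\<close>

definition mfps_compose ::
    "('a::comm_ring_1, 'n::finite) mfps \<Rightarrow> ('a, 'n) mfps ^ 'n \<Rightarrow> ('a, 'n) mfps" where
  "mfps_compose f \<phi> = Abs_mfps (\<lambda>e. \<Sum>a | mdeg a \<le> mdeg e.
     mfps_coeff f a * mfps_coeff (\<Prod>i\<in>UNIV. (\<phi> $ i) ^ a i) e)"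

lemma mfps_coeff_mult_eq_0:
  fixes f g :: "('a::comm_ring_1, 'n::finite) mfps"
  assumes "\<And>e. mdeg e < p \<Longrightarrow> mfps_coeff f e = 0"
    and "\<And>e. mdeg e < q \<Longrightarrow> mfps_coeff g e = 0"
    and "mdeg e < p + q"
  shows "mfps_coeff (f * g) e = 0"
proof -
  have "mfps_coeff f a * mfps_coeff g (e - a) = 0" if "a \<le> e" for a
  proof -
    have "mdeg e = (\<Sum>i\<in>UNIV. a i + (e - a) i)"
      using that by (simp add: mdeg_def le_fun_def)
    then have "mdeg e = mdeg a + mdeg (e - a)"
      by (simp only: mdeg_def sum.distrib)
    then have "mdeg a < p \<or> mdeg (e - a) < q"
      using assms(3) by linarith
    then show ?thesis
      using assms(1,2) by auto
  qed
  then show ?thesis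
    by (simp add: times_mfps_def)
qed

lemma mfps_coeff_power_eq_0:
  fixes f :: "('a::comm_ring_1, 'n::finite) mfps"
  assumes "mfps_coeff f (\<lambda>_. 0) = 0" and "mdeg e < k"
  shows "mfps_coeff (f ^ k) e = 0"
  using assms(2)
proof (induction k arbitrary: e)
  case (Suc k)
  have "mfps_coeff f d = 0" if "mdeg d < 1" for d
  proof -
    have "d = (\<lambda>_. 0)"
      using that by (auto simp: mdeg_def)
    then show ?thesis
      using assms(1) by simp
  qed
  then show ?case
    using mfps_coeff_mult_eq_0[of 1 f k "f ^ k" e] Suc by simp
qed simp

lemma mfps_coeff_monomial_eq_0:
  fixes \<phi> :: "('a::comm_ring_1, 'n::finite) mfps ^ 'n"
  assumes "\<And>i. mfps_coeff (\<phi> $ i) (\<lambda>_. 0) = 0" and "mdeg e < mdeg a"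
  shows "mfps_coeff (\<Prod>i\<in>UNIV. (\<phi> $ i) ^ a i) e = 0"
proof -
  have "mfps_coeff (\<Prod>i\<in>A. (\<phi> $ i) ^ a i) d = 0" if "finite A" "mdeg d < sum a A" for A d
    using that
  proof (induction A arbitrary: d rule: finite_induct)
    case (insert x A)
    then show ?case
      using mfps_coeff_mult_eq_0[of "a x" "(\<phi> $ x) ^ a x" "sum a A" "\<Prod>i\<in>A. (\<phi> $ i) ^ a i" d]
        mfps_coeff_power_eq_0[OF assms(1)]
      by simp
  qed simp
  then show ?thesis
    using assms(2) by (simp add: mdeg_def)
qed

lemma mfps_coeff_compose:
  fixes \<phi> :: "('a::comm_ring_1, 'n::finite) mfps ^ 'n"
  assumes "\<And>i. mfps_coeff (\<phi> $ i) (\<lambda>_. 0) = 0"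
    and "finite T" and "{a. mdeg a \<le> mdeg e} \<subseteq> T"
  shows "mfps_coeff (mfps_compose f \<phi>) e =
    (\<Sum>a\<in>T. mfps_coeff f a * mfps_coeff (\<Prod>i\<in>UNIV. (\<phi> $ i) ^ a i) e)"
  unfolding mfps_compose_def mfps_coeff_Abs
  using assms by (intro sum.mono_neutral_left) (auto simp: mfps_coeff_monomial_eq_0)

definition mfps_tuple_compose ::
    "('a::comm_ring_1, 'n::finite) mfps ^ 'n \<Rightarrow> ('a, 'n) mfps ^ 'n \<Rightarrow> ('a, 'n) mfps ^ 'n" where
  "mfps_tuple_compose \<phi> \<psi> = (\<chi> i. mfps_compose (\<phi> $ i) \<psi>)"

subsection \<open>Homogeneous components and the group of invertible series\<close>

definition homogeneous_part ::
    "nat \<Rightarrow> ('a::comm_ring_1, 'n::finite) mfps ^ 'n \<Rightarrow> ('a, 'n) mfps ^ 'n" where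
  "homogeneous_part k \<phi> =
     (\<chi> i. Abs_mfps (\<lambda>e. if mdeg e = k then mfps_coeff (\<phi> $ i) e else 0))"

text \<open>
  The matrix of a tuple of linear forms: entry \<open>(i, j)\<close> is the coefficient of \<open>x\<^sub>j\<close> in the
  \<open>i\<close>-th component.
\<close>

definition matrix_of_forms :: "('a::comm_ring_1, 'n::finite) mfps ^ 'n \<Rightarrow> 'a ^ 'n ^ 'n" where
  "matrix_of_forms \<phi> = (\<chi> i j. mfps_coeff (\<phi> $ i) (\<lambda>k. if k = j then 1 else 0))"

definition G_inf :: "(('a::field, 'n::finite) mfps ^ 'n) monoid" where
  "G_inf = \<lparr>carrier = {\<phi>. homogeneous_part 0 \<phi> = 0 \<and>
                          invertible (matrix_of_forms (homogeneous_part 1 \<phi>))},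
            mult = mfps_tuple_compose,
            one = (\<chi> i. mfps_var i)\<rparr>"

definition diagonalizable :: "'a::field ^ 'n ^ 'n \<Rightarrow> bool" where
  "diagonalizable A \<longleftrightarrow> (\<exists>P D :: 'a ^ 'n ^ 'n. invertible P \<and> (\<forall>i j. i \<noteq> j \<longrightarrow> D $ i $ j = 0) \<and>
     A = matrix_inv P ** D ** P)"

end

theory Submission
  imports Defs
begin

text \<open>
  The conjugating series is the average \<open>\<psi> = 1/m \<Sum>\<^sub>k \<phi>\<^sub>1\<^bsup>m-k\<^esup> \<phi>\<^bsup>k\<^esup>\<close> over \<open>k < m\<close>. Since \<open>\<phi>\<^bsup>m\<^esup> = id\<close>, also
  \<open>\<phi>\<^sub>1\<^bsup>m\<^esup> = id\<close>. Hence every summand has linear part \<open>id\<close>, so \<open>\<psi>\<close> is tangent to the identity,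
  and as composition with the linear \<open>\<phi>\<^sub>1\<close> on the left is additive, shifting the summation index
  gives \<open>\<phi>\<^sub>1 \<psi> = \<psi> \<phi>\<close>.
\<close>

section \<open>Coefficients and monomials\<close>

text \<open>The exponent of the single variable with index \<open>j\<close>, which occurs
  anonymously in \<open>mfps_var\<close> and \<open>matrix_of_forms\<close>.\<close>

definition unit_exp :: "'n \<Rightarrow> 'n \<Rightarrow> nat" where
  "unit_exp j = (\<lambda>k. if k = j then 1 else 0)"

lemma mfps_coeff_simps [simp]:
  "mfps_coeff 0 e = 0"
  "mfps_coeff (f + g) e = mfps_coeff f e + mfps_coeff g e"
  "mfps_coeff (f - g) e = mfps_coeff f e - mfps_coeff g e"
  by (simp_all add: zero_mfps_def plus_mfps_def minus_mfps_def)

lemma mfps_coeff_one: "mfps_coeff 1 e = (if e = (\<lambda>_. 0) then 1 else 0)"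
  by (simp add: one_mfps_def)

lemma mfps_coeff_mult: "mfps_coeff (f * g) e = (\<Sum>a\<le>e. mfps_coeff f a * mfps_coeff g (e - a))"
  by (simp add: times_mfps_def)

lemma mfps_coeff_sum [simp]: "mfps_coeff (sum f A) e = (\<Sum>x\<in>A. mfps_coeff (f x) e)"
  by (induction A rule: infinite_finite_induct) auto

lemma mdeg_zero [simp]: "mdeg (\<lambda>_. 0) = 0"
  by (simp add: mdeg_def)

lemma mdeg_eq_0_iff [simp]: "mdeg e = 0 \<longleftrightarrow> e = (\<lambda>_. 0)"
  by (auto simp: mdeg_def)

lemma mdeg_add [simp]: "mdeg (\<lambda>i. a i + b i) = mdeg a + mdeg b"
  by (simp add: mdeg_def sum.distrib)

lemma mdeg_unit_exp [simp]: "mdeg (unit_exp j) = 1"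
  by (simp add: mdeg_def unit_exp_def)

lemma unit_exp_eq_iff [simp]: "unit_exp i = unit_exp j \<longleftrightarrow> i = j"
  by (metis unit_exp_def zero_neq_one)

lemma unit_exp_neq_zero [simp]: "unit_exp i \<noteq> (\<lambda>_. 0)" "(\<lambda>_. 0) \<noteq> unit_exp i"
  by (metis unit_exp_def zero_neq_one)+

lemma mdeg_eq_1D:
  assumes "mdeg e = 1"
  obtains j where "e = unit_exp j"
proof -
  from assms obtain j where j: "e j \<noteq> 0"
    by (fastforce simp: mdeg_def)
  have "e j + (\<Sum>k\<in>UNIV - {j}. e k) = 1"
    using assms by (simp add: mdeg_def sum.remove[of UNIV j])
  with j have "e j = 1" "(\<Sum>k\<in>UNIV - {j}. e k) = 0"
    by linarith+
  then have "e = unit_exp j"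
    by (auto simp: fun_eq_iff unit_exp_def)
  then show thesis ..
qed

text \<open>Lists the terms that survive the cut-off when a composition is evaluated at an exponent
  of degree 1.\<close>

lemma exponents_mdeg_le_1:
  "{a :: 'n::finite \<Rightarrow> nat. mdeg a \<le> 1} = insert (\<lambda>_. 0) (range unit_exp)"
proof -
  have "a \<in> insert (\<lambda>_. 0) (range unit_exp)" if "mdeg a \<le> 1" for a :: "'n \<Rightarrow> nat"
  proof (cases "mdeg a = 0")
    case False
    with that have "mdeg a = 1"
      by linarith
    then show ?thesis
      by (elim mdeg_eq_1D) auto
  qed auto
  then show ?thesis
    by auto
qed

section \<open>Monomial series and their products\<close>

definition mfps_monom :: "('n::finite \<Rightarrow> nat) \<Rightarrow> ('a::comm_ring_1, 'n) mfps" where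
  "mfps_monom a = Abs_mfps (\<lambda>e. if e = a then 1 else 0)"

lemma mfps_coeff_monom [simp]: "mfps_coeff (mfps_monom a) e = (if e = a then 1 else 0)"
  by (simp add: mfps_monom_def)

lemma mfps_monom_zero: "mfps_monom (\<lambda>_. 0) = 1"
  by (simp add: mfps_eq_iff mfps_coeff_one)

lemma mfps_var_eq_monom: "mfps_var j = mfps_monom (unit_exp j)"
  by (simp add: mfps_monom_def mfps_var_def unit_exp_def)

lemma mfps_monom_mult: "mfps_monom a * mfps_monom b = mfps_monom (\<lambda>i. a i + b i)"
  unfolding mfps_eq_iff
proof
  fix e
  have "mfps_coeff (mfps_monom a * mfps_monom b :: ('a, 'b) mfps) e
      = (\<Sum>c\<le>e. if c = a then (if e - a = b then 1 else 0) else 0)"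
    unfolding mfps_coeff_mult by (rule sum.cong) auto
  also have "\<dots> = (if a \<le> e \<and> e - a = b then 1 else 0)"
    by simp
  also have "a \<le> e \<and> e - a = b \<longleftrightarrow> e = (\<lambda>i. a i + b i)"
    by (auto simp: le_fun_def fun_eq_iff) (metis le_add_diff_inverse)
  finally show "mfps_coeff (mfps_monom a * mfps_monom b :: ('a, 'b) mfps) e
      = mfps_coeff (mfps_monom (\<lambda>i. a i + b i)) e"
    by simp
qed

lemma mfps_monom_power: "mfps_monom a ^ k = mfps_monom (\<lambda>i. k * a i)"
  by (induction k) (simp_all add: mfps_monom_zero mfps_monom_mult)

lemma mfps_monom_prod: "(\<Prod>x\<in>A. mfps_monom (a x)) = mfps_monom (\<lambda>i. \<Sum>x\<in>A. a x i)"
  by (induction A rule: infinite_finite_induct) (simp_all add: mfps_monom_zero mfps_monom_mult)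

text \<open>Exhibits a monomial as the power product of the identity tuple, to be compared factor by
  factor with that of another tuple.\<close>

lemma prod_mfps_var_power: "(\<Prod>i\<in>UNIV. mfps_var i ^ a i) = mfps_monom a"
proof -
  have "(\<lambda>i. \<Sum>x\<in>UNIV. a x * unit_exp x i) = a"
  proof
    fix i
    have "(\<Sum>x\<in>UNIV. a x * unit_exp x i) = (\<Sum>x\<in>UNIV. if x = i then a x else 0)"
      by (rule sum.cong) (auto simp: unit_exp_def)
    then show "(\<Sum>x\<in>UNIV. a x * unit_exp x i) = a i"
      by simp
  qed
  then show ?thesis
    unfolding mfps_var_eq_monom mfps_monom_power mfps_monom_prod by simp
qed

section \<open>Composition as a ring homomorphism\<close>

text \<open>The condition under which the cut-off in \<open>mfps_compose\<close> discards only zero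
  terms, kept apart from invertibility of the linear part.\<close>

definition zero_const :: "('a::comm_ring_1, 'n::finite) mfps ^ 'n \<Rightarrow> bool" where
  "zero_const \<phi> \<longleftrightarrow> (\<forall>i. mfps_coeff (\<phi> $ i) (\<lambda>_. 0) = 0)"

text \<open>The result of substituting \<phi> into the monomial with exponent \<open>a\<close>;
  composition extends this linearly to series.\<close>

definition mfps_powers ::
    "('a::comm_ring_1, 'n::finite) mfps ^ 'n \<Rightarrow> ('n \<Rightarrow> nat) \<Rightarrow> ('a, 'n) mfps" where
  "mfps_powers \<phi> a = (\<Prod>i\<in>UNIV. (\<phi> $ i) ^ a i)"

lemma mfps_powers_zero [simp]: "mfps_powers \<phi> (\<lambda>_. 0) = 1"
  by (simp add: mfps_powers_def)

lemma mfps_powers_unit_exp [simp]: "mfps_powers \<phi> (unit_exp j) = \<phi> $ j"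
proof -
  have "mfps_powers \<phi> (unit_exp j) = (\<Prod>i\<in>UNIV. if i = j then \<phi> $ i else 1)"
    unfolding mfps_powers_def by (rule prod.cong) (auto simp: unit_exp_def)
  then show ?thesis
    by simp
qed

lemma mfps_powers_add: "mfps_powers \<phi> (\<lambda>i. a i + b i) = mfps_powers \<phi> a * mfps_powers \<phi> b"
  by (simp add: mfps_powers_def power_add prod.distrib)

lemma mfps_coeff_powers_eq_0:
  assumes "zero_const \<phi>" "mdeg e < mdeg a"
  shows "mfps_coeff (mfps_powers \<phi> a) e = 0"
  using mfps_coeff_monomial_eq_0 assms unfolding mfps_powers_def zero_const_def by blast

lemma mfps_coeff_compose_mdeg:
  "mfps_coeff (mfps_compose f \<phi>) e
    = (\<Sum>a | mdeg a \<le> mdeg e. mfps_coeff f a * mfps_coeff (mfps_powers \<phi> a) e)"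
  by (simp add: mfps_compose_def mfps_powers_def)

text \<open>Raising the cut-off to a common bound \<open>N\<close> allows coefficients at different
  exponents to be summed over the same index set.\<close>

lemma mfps_coeff_compose_le:
  assumes "zero_const \<phi>" "mdeg e \<le> N"
  shows "mfps_coeff (mfps_compose f \<phi>) e
    = (\<Sum>a | mdeg a \<le> N. mfps_coeff f a * mfps_coeff (mfps_powers \<phi> a) e)"
  unfolding mfps_powers_def
  by (rule mfps_coeff_compose) (use assms in \<open>auto simp: zero_const_def\<close>)

section \<open>Linearity and multiplicativity of substitution\<close>

lemma mfps_compose_add: "mfps_compose (f + g) \<phi> = mfps_compose f \<phi> + mfps_compose g \<phi>"
  by (simp add: mfps_eq_iff mfps_coeff_compose_mdeg algebra_simps sum.distrib)

lemma mfps_compose_zero [simp]: "mfps_compose 0 \<phi> = 0"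
  by (simp add: mfps_eq_iff mfps_coeff_compose_mdeg)

lemma mfps_compose_sum: "mfps_compose (sum f A) \<phi> = (\<Sum>x\<in>A. mfps_compose (f x) \<phi>)"
  by (induction A rule: infinite_finite_induct) (simp_all add: mfps_compose_add)

lemma mfps_compose_monom:
  assumes "zero_const \<phi>"
  shows "mfps_compose (mfps_monom a) \<phi> = mfps_powers \<phi> a"
  unfolding mfps_eq_iff
proof
  fix e
  have "mfps_coeff (mfps_compose (mfps_monom a) \<phi>) e
      = (\<Sum>b | mdeg b \<le> mdeg e. if b = a then mfps_coeff (mfps_powers \<phi> a) e else 0)"
    unfolding mfps_coeff_compose_mdeg by (rule sum.cong) auto
  \<comment> \<open>If the degree of \<open>a\<close> exceeds the cut-off, the sum is zero, and so
    is the right-hand side.\<close>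
  also have "\<dots> = mfps_coeff (mfps_powers \<phi> a) e"
    using mfps_coeff_powers_eq_0[OF assms, of e a] by (auto simp: not_le)
  finally show "mfps_coeff (mfps_compose (mfps_monom a) \<phi>) e = mfps_coeff (mfps_powers \<phi> a) e" .
qed

lemma mfps_compose_one [simp]: "zero_const \<phi> \<Longrightarrow> mfps_compose 1 \<phi> = 1"
  using mfps_compose_monom[of \<phi> "\<lambda>_. 0"] by (simp add: mfps_monom_zero)

lemma mfps_compose_var: "zero_const \<phi> \<Longrightarrow> mfps_compose (mfps_var j) \<phi> = \<phi> $ j"
  by (simp add: mfps_var_eq_monom mfps_compose_monom)

text \<open>Both sides expand into sums over pairs \<open>(a, b)\<close> of the same terms. The
  index ranges differ only in pairs of total degree above \<open>mdeg e\<close>, whose power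
  products vanish at \<open>e\<close>.\<close>

lemma mfps_compose_mult:
  fixes f g :: "('a::comm_ring_1, 'n::finite) mfps"
  assumes "zero_const \<phi>"
  shows "mfps_compose (f * g) \<phi> = mfps_compose f \<phi> * mfps_compose g \<phi>"
  unfolding mfps_eq_iff
proof
  fix e :: "'n \<Rightarrow> nat"
  let ?T = "{a :: 'n \<Rightarrow> nat. mdeg a \<le> mdeg e}"
  let ?h = "\<lambda>a b. mfps_coeff f a * mfps_coeff g b
      * mfps_coeff (mfps_powers \<phi> a * mfps_powers \<phi> b) e"
  have "mfps_coeff (mfps_compose (f * g) \<phi>) e
      = (\<Sum>(c, a)\<in>Sigma ?T (\<lambda>c. {..c}). mfps_coeff f a * mfps_coeff g (c - a)
            * mfps_coeff (mfps_powers \<phi> c) e)"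
    by (simp add: mfps_coeff_compose_mdeg mfps_coeff_mult sum_distrib_right sum.Sigma)
  also have "\<dots> = (\<Sum>(a, b) | mdeg a + mdeg b \<le> mdeg e. ?h a b)"
  proof (rule sum.reindex_bij_witness
      [where i = "\<lambda>(a, b). (\<lambda>i. a i + b i, a)" and j = "\<lambda>(c, a). (a, c - a)"])
    fix x assume "x \<in> Sigma ?T (\<lambda>c. {..c})"
    then obtain c a where x: "x = (c, a)" and c: "mdeg c \<le> mdeg e" and "a \<le> c"
      by auto
    then have c_eq: "c = (\<lambda>i. a i + (c - a) i)"
      by (auto simp: le_fun_def fun_eq_iff)
    have "mdeg a + mdeg (c - a) = mdeg c"
      using arg_cong[OF c_eq, of mdeg] by (simp only: mdeg_add)
    with c show "(case x of (c, a) \<Rightarrow> (a, c - a)) \<in> {(a, b). mdeg a + mdeg b \<le> mdeg e}"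
      by (simp add: x)
    show "(case case x of (c, a) \<Rightarrow> (a, c - a) of (a, b) \<Rightarrow> (\<lambda>i. a i + b i, a)) = x"
      using c_eq by (simp add: x)
    have "mfps_powers \<phi> c = mfps_powers \<phi> a * mfps_powers \<phi> (c - a)"
      using arg_cong[OF c_eq, of "mfps_powers \<phi>"] by (simp only: mfps_powers_add)
    then show "(case case x of (c, a) \<Rightarrow> (a, c - a) of (a, b) \<Rightarrow> ?h a b)
      = (case x of (c, a) \<Rightarrow> mfps_coeff f a * mfps_coeff g (c - a)
            * mfps_coeff (mfps_powers \<phi> c) e)"
      by (simp add: x)
  qed (auto simp: le_fun_def fun_eq_iff)
  \<comment> \<open>The triangle of pairs is enlarged to a square so that the double sum can later
    factor.\<close>
  also have "\<dots> = (\<Sum>(a, b)\<in>?T \<times> ?T. ?h a b)"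
  proof (rule sum.mono_neutral_left)
    show "\<forall>x\<in>?T \<times> ?T - {(a, b). mdeg a + mdeg b \<le> mdeg e}. (case x of (a, b) \<Rightarrow> ?h a b) = 0"
    proof
      fix x assume "x \<in> ?T \<times> ?T - {(a, b). mdeg a + mdeg b \<le> mdeg e}"
      then obtain a b where x: "x = (a, b)" and "mdeg e < mdeg a + mdeg b"
        by (cases x) auto
      then have "mfps_coeff (mfps_powers \<phi> a * mfps_powers \<phi> b) e = 0"
        using mfps_coeff_powers_eq_0[OF assms, of e "\<lambda>i. a i + b i"]
        by (simp add: mfps_powers_add)
      then show "(case x of (a, b) \<Rightarrow> ?h a b) = 0"
        by (simp add: x)
    qed
  qed auto
  also have "\<dots> = (\<Sum>a\<in>?T. \<Sum>b\<in>?T. \<Sum>d\<le>e. mfps_coeff f a * mfps_coeff (mfps_powers \<phi> a) d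
      * (mfps_coeff g b * mfps_coeff (mfps_powers \<phi> b) (e - d)))"
    by (simp add: sum.cartesian_product[symmetric] mfps_coeff_mult sum_distrib_left mult_ac)
  also have "\<dots> = (\<Sum>a\<in>?T. \<Sum>d\<le>e. \<Sum>b\<in>?T. mfps_coeff f a * mfps_coeff (mfps_powers \<phi> a) d
      * (mfps_coeff g b * mfps_coeff (mfps_powers \<phi> b) (e - d)))"
    by (intro sum.cong refl sum.swap)
  also have "\<dots> = (\<Sum>d\<le>e. \<Sum>a\<in>?T. \<Sum>b\<in>?T. mfps_coeff f a * mfps_coeff (mfps_powers \<phi> a) d
      * (mfps_coeff g b * mfps_coeff (mfps_powers \<phi> b) (e - d)))"
    by (rule sum.swap)
  also have "\<dots> = (\<Sum>d\<le>e. mfps_coeff (mfps_compose f \<phi>) d * mfps_coeff (mfps_compose g \<phi>) (e - d))"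
  proof (rule sum.cong)
    \<comment> \<open>Both \<open>d\<close> and \<open>e - d\<close> have degree at most
      \<open>mdeg e\<close>, so the common cut-off is legitimate for both factors.\<close>
    fix d assume "d \<in> {..e}"
    then have "mdeg d \<le> mdeg e" "mdeg (e - d) \<le> mdeg e"
      by (auto simp: mdeg_def le_fun_def intro!: sum_mono)
    then show "(\<Sum>a\<in>?T. \<Sum>b\<in>?T. mfps_coeff f a * mfps_coeff (mfps_powers \<phi> a) d
        * (mfps_coeff g b * mfps_coeff (mfps_powers \<phi> b) (e - d)))
      = mfps_coeff (mfps_compose f \<phi>) d * mfps_coeff (mfps_compose g \<phi>) (e - d)"
      by (simp add: mfps_coeff_compose_le[OF assms] sum_product)
  qed simp
  finally show "mfps_coeff (mfps_compose (f * g) \<phi>) e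
      = mfps_coeff (mfps_compose f \<phi> * mfps_compose g \<phi>) e"
    by (simp only: mfps_coeff_mult)
qed

lemma mfps_compose_power:
  "zero_const \<phi> \<Longrightarrow> mfps_compose (f ^ k) \<phi> = mfps_compose f \<phi> ^ k"
  by (induction k) (simp_all add: mfps_compose_mult)

lemma mfps_compose_prod:
  "zero_const \<phi> \<Longrightarrow> mfps_compose (prod f A) \<phi> = (\<Prod>x\<in>A. mfps_compose (f x) \<phi>)"
  by (induction A rule: infinite_finite_induct) (simp_all add: mfps_compose_mult)

text \<open>The case of associativity in which the outermost series is a monomial: a ring
  homomorphism preserves power products.\<close>

lemma mfps_compose_powers:
  assumes "zero_const \<psi>"
  shows "mfps_compose (mfps_powers \<phi> a) \<psi> = mfps_powers (mfps_tuple_compose \<phi> \<psi>) a"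
  by (simp add: mfps_powers_def mfps_compose_prod[OF assms] mfps_compose_power[OF assms]
      mfps_tuple_compose_def)

lemma mfps_coeff_compose_zero [simp]: "mfps_coeff (mfps_compose f \<phi>) (\<lambda>_. 0) = mfps_coeff f (\<lambda>_. 0)"
  by (simp add: mfps_coeff_compose_mdeg mfps_coeff_one)

lemma zero_const_tuple_compose:
  "zero_const (mfps_tuple_compose \<phi> \<psi>) \<longleftrightarrow> zero_const \<phi>"
  by (simp add: zero_const_def mfps_tuple_compose_def)

text \<open>With the same cut-off \<open>mdeg e\<close> for both sums, exchanging them reduces the
  claim to monomials, settled by \<open>mfps_compose_powers\<close>.\<close>

lemma mfps_compose_assoc:
  fixes f :: "('a::comm_ring_1, 'n::finite) mfps"
  assumes "zero_const \<phi>" "zero_const \<psi>"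
  shows "mfps_compose (mfps_compose f \<phi>) \<psi> = mfps_compose f (mfps_tuple_compose \<phi> \<psi>)"
  unfolding mfps_eq_iff
proof
  fix e :: "'n \<Rightarrow> nat"
  let ?T = "{a :: 'n \<Rightarrow> nat. mdeg a \<le> mdeg e}"
  have "mfps_coeff (mfps_compose (mfps_compose f \<phi>) \<psi>) e
      = (\<Sum>b\<in>?T. \<Sum>a\<in>?T. mfps_coeff f a * mfps_coeff (mfps_powers \<phi> a) b
            * mfps_coeff (mfps_powers \<psi> b) e)"
    by (simp add: mfps_coeff_compose_mdeg[of _ _ e] mfps_coeff_compose_le[OF assms(1), of _ "mdeg e"]
        sum_distrib_right)
  also have "\<dots> = (\<Sum>a\<in>?T. mfps_coeff f a * mfps_coeff (mfps_compose (mfps_powers \<phi> a) \<psi>) e)"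
    by (subst sum.swap) (simp add: mfps_coeff_compose_mdeg sum_distrib_left mult.assoc)
  also have "\<dots> = mfps_coeff (mfps_compose f (mfps_tuple_compose \<phi> \<psi>)) e"
    by (simp add: mfps_compose_powers[OF assms(2)] mfps_coeff_compose_mdeg)
  finally show "mfps_coeff (mfps_compose (mfps_compose f \<phi>) \<psi>) e
      = mfps_coeff (mfps_compose f (mfps_tuple_compose \<phi> \<psi>)) e" .
qed

lemma mfps_tuple_compose_assoc:
  assumes "zero_const \<psi>" "zero_const \<theta>"
  shows "mfps_tuple_compose (mfps_tuple_compose \<phi> \<psi>) \<theta>
    = mfps_tuple_compose \<phi> (mfps_tuple_compose \<psi> \<theta>)"
  by (simp add: mfps_tuple_compose_def[of _ \<theta>] mfps_tuple_compose_def[of \<phi>]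
      mfps_compose_assoc[OF assms] vec_eq_iff)

section \<open>Linear parts\<close>

lemma matrix_of_forms_nth: "matrix_of_forms \<phi> $ i $ j = mfps_coeff (\<phi> $ i) (unit_exp j)"
  by (simp add: matrix_of_forms_def unit_exp_def)

text \<open>At an exponent of degree 1 only exponents of degree at most 1 contribute. The constant
  term drops out and the rest is the matrix product.\<close>

lemma matrix_of_forms_compose:
  assumes "zero_const \<phi>" "zero_const \<psi>"
  shows "matrix_of_forms (mfps_tuple_compose \<phi> \<psi>) = matrix_of_forms \<phi> ** matrix_of_forms \<psi>"
proof -
  have "mfps_coeff (mfps_compose (\<phi> $ i) \<psi>) (unit_exp j)
      = (\<Sum>k\<in>UNIV. mfps_coeff (\<phi> $ i) (unit_exp k) * mfps_coeff (\<psi> $ k) (unit_exp j))" for i j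
  proof -
    have "mfps_coeff (mfps_compose (\<phi> $ i) \<psi>) (unit_exp j)
        = (\<Sum>a\<in>insert (\<lambda>_. 0) (range unit_exp).
            mfps_coeff (\<phi> $ i) a * mfps_coeff (mfps_powers \<psi> a) (unit_exp j))"
      unfolding mfps_coeff_compose_mdeg mdeg_unit_exp exponents_mdeg_le_1 ..
    also have "\<dots> = (\<Sum>a\<in>range unit_exp.
            mfps_coeff (\<phi> $ i) a * mfps_coeff (mfps_powers \<psi> a) (unit_exp j))"
      using assms(1) by (subst sum.insert) (auto simp: zero_const_def)
    also have "\<dots> = (\<Sum>k\<in>UNIV. mfps_coeff (\<phi> $ i) (unit_exp k) * mfps_coeff (\<psi> $ k) (unit_exp j))"
      by (subst sum.reindex) (auto simp: inj_on_def)
    finally show ?thesis .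
  qed
  then show ?thesis
    by (simp add: vec_eq_iff matrix_of_forms_nth mfps_tuple_compose_def matrix_matrix_mult_def)
qed

lemma matrix_of_forms_id [simp]: "matrix_of_forms (\<chi> i. mfps_var i) = mat 1"
  by (auto simp: vec_eq_iff matrix_of_forms_nth mfps_var_eq_monom mat_def)

lemma zero_const_id [simp]: "zero_const (\<chi> i. mfps_var i)"
  by (simp add: zero_const_def mfps_var_eq_monom)

definition mfps_smult :: "'a::comm_ring_1 \<Rightarrow> ('a, 'n::finite) mfps \<Rightarrow> ('a, 'n) mfps" where
  "mfps_smult c f = Abs_mfps (\<lambda>e. c * mfps_coeff f e)"

lemma mfps_coeff_smult [simp]: "mfps_coeff (mfps_smult c f) e = c * mfps_coeff f e"
  by (simp add: mfps_smult_def)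

lemma mfps_compose_smult: "mfps_compose (mfps_smult c f) \<phi> = mfps_smult c (mfps_compose f \<phi>)"
  by (simp add: mfps_eq_iff mfps_coeff_compose_mdeg sum_distrib_left mult.assoc)

text \<open>The identification of matrices with tuples of linear forms, in the direction opposite to
  \<open>matrix_of_forms\<close>.\<close>

definition linear_forms :: "'a::comm_ring_1 ^ 'n ^ 'n \<Rightarrow> ('a, 'n::finite) mfps ^ 'n" where
  "linear_forms A = (\<chi> i. \<Sum>j\<in>UNIV. mfps_smult (A $ i $ j) (mfps_var j))"

lemma linear_forms_compose:
  assumes "zero_const \<phi>"
  shows "mfps_tuple_compose (linear_forms A) \<phi> = (\<chi> i. \<Sum>j\<in>UNIV. mfps_smult (A $ i $ j) (\<phi> $ j))"
  by (simp add: mfps_tuple_compose_def linear_forms_def vec_eq_iff mfps_compose_sum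
      mfps_compose_smult mfps_compose_var[OF assms])

lemma zero_const_linear_forms [simp]: "zero_const (linear_forms A)"
  by (simp add: zero_const_def linear_forms_def mfps_var_eq_monom)

lemma matrix_of_forms_linear_forms [simp]: "matrix_of_forms (linear_forms A) = A"
  by (simp add: vec_eq_iff matrix_of_forms_nth linear_forms_def mfps_var_eq_monom
      if_distrib[of "\<lambda>x. _ * x"] cong: if_cong)

text \<open>Every exponent of degree 1 is a \<open>unit_exp\<close>, so the linear part is
  determined by the matrix of \<phi> itself.\<close>

lemma homogeneous_part_1_eq: "homogeneous_part 1 \<phi> = linear_forms (matrix_of_forms \<phi>)"
proof -
  have "(if mdeg e = 1 then mfps_coeff (\<phi> $ i) e else 0)
      = (\<Sum>j\<in>UNIV. mfps_coeff (\<phi> $ i) (unit_exp j) * (if e = unit_exp j then 1 else 0))" for i e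
  proof (cases "mdeg e = 1")
    case True
    then obtain k where "e = unit_exp k"
      by (rule mdeg_eq_1D)
    then show ?thesis
      by (simp add: if_distrib[of "\<lambda>x. _ * x"] cong: if_cong)
  next
    case False
    then have "e \<noteq> unit_exp j" for j
      by auto
    with False show ?thesis
      by simp
  qed
  then show ?thesis
    by (simp add: homogeneous_part_def linear_forms_def vec_eq_iff mfps_eq_iff
        matrix_of_forms_nth mfps_var_eq_monom)
qed

lemma linear_forms_mult:
  "mfps_tuple_compose (linear_forms A) (linear_forms B) = linear_forms (A ** B)"
proof -
  have "(\<Sum>j\<in>UNIV. A $ i $ j * (\<Sum>k\<in>UNIV. B $ j $ k * c k))
      = (\<Sum>k\<in>UNIV. (\<Sum>j\<in>UNIV. A $ i $ j * B $ j $ k) * c k)" for i c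
    by (simp add: sum_distrib_left sum_distrib_right mult.assoc) (rule sum.swap)
  then show ?thesis
    by (simp only: linear_forms_compose zero_const_linear_forms vec_eq_iff mfps_eq_iff)
       (simp add: linear_forms_def matrix_matrix_mult_def)
qed

lemma linear_forms_mat_1: "linear_forms (mat 1) = (\<chi> i. mfps_var i)"
  by (simp add: linear_forms_def vec_eq_iff mfps_eq_iff mat_def if_distrib[of "\<lambda>x. x * _"]
      cong: if_cong)

section \<open>Left inverses\<close>

text \<open>For \<open>\<phi>\<close> tangent to the identity, the system \<open>f(\<phi>) = g\<close> is unitriangular in the degree.\<close>

lemma mfps_coeff_powers_tangent_id:
  fixes \<phi> :: "('a::comm_ring_1, 'n::finite) mfps ^ 'n"
  assumes "zero_const \<phi>" "matrix_of_forms \<phi> = mat 1" "mdeg e \<le> mdeg a"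
  shows "mfps_coeff (mfps_powers \<phi> a) e = (if e = a then 1 else 0)"
proof -
  \<comment> \<open>\<open>V p f\<close> says that \<open>f\<close> has order at least
    \<open>p\<close>; \<open>P p f g\<close> says that \<open>f\<close> and \<open>g\<close> both do
    and have the same homogeneous part of degree \<open>p\<close>.\<close>
  define V where "V p f \<longleftrightarrow> (\<forall>e. mdeg e < p \<longrightarrow> mfps_coeff f e = 0)"
    for p and f :: "('a, 'n) mfps"
  define P where "P p f g \<longleftrightarrow> V p f \<and> V p g \<and> V (Suc p) (f - g)" for p f g
  have V_mult: "V (p + q) (f * g)" if "V p f" "V q g" for p q f g
    using mfps_coeff_mult_eq_0[of p f q g] that by (auto simp: V_def)
  have P_mult: "P (p + q) (f * f') (g * g')" if "P p f g" "P q f' g'" for p q f f' g g'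
  proof -
    \<comment> \<open>Each summand multiplies a difference, whose order is one higher, by a series
      of the expected order.\<close>
    have "f * f' - g * g' = (f - g) * f' + g * (f' - g')"
      by (simp add: algebra_simps)
    moreover have "V (Suc (p + q)) ((f - g) * f')" "V (Suc (p + q)) (g * (f' - g'))"
      using V_mult[of "Suc p" "f - g" q f'] V_mult[of p g "Suc q" "f' - g'"] that
      by (auto simp: P_def)
    ultimately have "V (Suc (p + q)) (f * f' - g * g')"
      by (simp add: V_def)
    with that show ?thesis
      by (simp add: P_def V_mult)
  qed
  have P_one: "P 0 1 1"
    by (simp add: P_def V_def)
  have P_var: "P 1 (\<phi> $ i) (mfps_var i)" for i
  proof -
    have "mfps_coeff (\<phi> $ i) d = mfps_coeff (mfps_var i) d" if d: "mdeg d < 2" for d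
    proof (cases "mdeg d = 0")
      case True
      then show ?thesis
        using assms(1) by (simp add: zero_const_def mfps_var_eq_monom)
    next
      case False
      with d have "mdeg d = 1"
        by linarith
      then obtain j where "d = unit_exp j"
        by (rule mdeg_eq_1D)
      moreover have "matrix_of_forms \<phi> $ i $ j = mat 1 $ i $ j"
        using assms(2) by simp
      ultimately show ?thesis
        by (auto simp: matrix_of_forms_nth mfps_var_eq_monom mat_def)
    qed
    then show ?thesis
      using assms(1) by (auto simp: P_def V_def zero_const_def mfps_var_eq_monom)
  qed
  have P_power: "P k (\<phi> $ i ^ k) (mfps_var i ^ k)" for i k
    by (induction k) (use P_one P_mult[OF P_var] in auto)
  have "P (sum a A) (\<Prod>i\<in>A. \<phi> $ i ^ a i) (\<Prod>i\<in>A. mfps_var i ^ a i)" if "finite A" for A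
    using that by (induction A rule: finite_induct) (use P_one P_mult[OF P_power] in auto)
  then have "P (mdeg a) (mfps_powers \<phi> a) (mfps_monom a)"
    by (simp add: mdeg_def mfps_powers_def flip: prod_mfps_var_power)
  then have "mfps_coeff (mfps_powers \<phi> a - mfps_monom a) e = 0"
    using assms(3) unfolding P_def V_def by (meson le_imp_less_Suc)
  then show ?thesis
    by simp
qed

text \<open>Forward substitution by degree for the system with matrix \<open>C\<close> and
  right-hand side \<open>g\<close>, where \<open>C\<close> is the identity within each degree and
  has no entries from higher to lower degree.\<close>

function triangular_solution ::
    "(('n::finite \<Rightarrow> nat) \<Rightarrow> ('n \<Rightarrow> nat) \<Rightarrow> 'a::comm_ring_1) \<Rightarrow> (('n \<Rightarrow> nat) \<Rightarrow> 'a) \<Rightarrow> ('n \<Rightarrow> nat) \<Rightarrow> 'a"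
where
  "triangular_solution C g e = g e - (\<Sum>a | mdeg a < mdeg e. triangular_solution C g a * C a e)"
  by auto
termination
  by (relation "measure (\<lambda>(_, _, e). mdeg e)") auto

declare triangular_solution.simps [simp del]

lemma mfps_compose_surj:
  fixes \<phi> :: "('a::comm_ring_1, 'n::finite) mfps ^ 'n"
  assumes "zero_const \<phi>" "matrix_of_forms \<phi> = mat 1"
  shows "\<exists>f. mfps_compose f \<phi> = g"
proof -
  define s where "s = triangular_solution (\<lambda>a. mfps_coeff (mfps_powers \<phi> a)) (mfps_coeff g)"
  have "mfps_coeff (mfps_compose (Abs_mfps s) \<phi>) e = mfps_coeff g e" for e
  proof -
    let ?h = "\<lambda>a. s a * mfps_coeff (mfps_powers \<phi> a) e"
    have fin: "finite {a :: 'n \<Rightarrow> nat. mdeg a < mdeg e}"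
      by (rule finite_subset[OF _ finite_mdeg_le[of "mdeg e"]]) auto
    \<comment> \<open>Among the exponents of the same degree as \<open>e\<close>, only
      \<open>e\<close> itself contributes.\<close>
    have "(\<Sum>a | mdeg a \<le> mdeg e. ?h a) = (\<Sum>a\<in>insert e {a. mdeg a < mdeg e}. ?h a)"
      by (rule sum.mono_neutral_right)
        (use mfps_coeff_powers_tangent_id[OF assms] in \<open>auto simp: not_less\<close>)
    also have "\<dots> = s e + (\<Sum>a | mdeg a < mdeg e. ?h a)"
      using mfps_coeff_powers_tangent_id[OF assms, of e e] fin by simp
    also have "\<dots> = mfps_coeff g e"
      unfolding s_def by (subst triangular_solution.simps) simp
    finally show ?thesis
      by (simp add: mfps_coeff_compose_mdeg)
  qed
  then show ?thesis
    by (auto simp: mfps_eq_iff)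
qed

text \<open>Composing on the left with the inverse matrix \<open>B\<close> makes the series tangent
  to the identity. Solving for each variable then inverts \<theta> from the left, and
  \<open>B\<close> is absorbed into the inverse by associativity.\<close>

lemma mfps_tuple_compose_left_inverse:
  fixes \<phi> :: "('a::comm_ring_1, 'n::finite) mfps ^ 'n"
  assumes "zero_const \<phi>" "invertible (matrix_of_forms \<phi>)"
  obtains \<psi> where "zero_const \<psi>" "mfps_tuple_compose \<psi> \<phi> = (\<chi> i. mfps_var i)"
proof -
  obtain B where B: "B ** matrix_of_forms \<phi> = mat 1"
    using assms(2) by (auto simp: invertible_def)
  define \<theta> where "\<theta> = mfps_tuple_compose (linear_forms B) \<phi>"
  have \<theta>: "zero_const \<theta>" "matrix_of_forms \<theta> = mat 1"
    using assms B by (simp_all add: \<theta>_def zero_const_tuple_compose matrix_of_forms_compose)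
  have "\<exists>F. \<forall>i. mfps_compose (F i) \<theta> = mfps_var i"
    by (intro choice allI mfps_compose_surj[OF \<theta>])
  then obtain F where F: "\<And>i. mfps_compose (F i) \<theta> = mfps_var i"
    by blast
  then have comp: "mfps_tuple_compose (vec_lambda F) \<theta> = (\<chi> i. mfps_var i)"
    by (simp add: mfps_tuple_compose_def)
  \<comment> \<open>Composition preserves the constant terms of its left argument, and the identity
    has none.\<close>
  then have "zero_const (vec_lambda F)"
    by (metis zero_const_id zero_const_tuple_compose)
  then show thesis
    using that[of "mfps_tuple_compose (vec_lambda F) (linear_forms B)"] comp assms(1)
    by (simp add: zero_const_tuple_compose mfps_tuple_compose_assoc \<theta>_def)
qed

section \<open>The group and the averaged series\<close>

lemma carrier_G_inf: "\<phi> \<in> carrier G_inf \<longleftrightarrow> zero_const \<phi> \<and> invertible (matrix_of_forms \<phi>)"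
proof -
  have "homogeneous_part 0 \<phi> = 0 \<longleftrightarrow> zero_const \<phi>"
    by (auto simp: homogeneous_part_def zero_const_def vec_eq_iff mfps_eq_iff)
  then show ?thesis
    by (simp add: G_inf_def homogeneous_part_1_eq[unfolded One_nat_def])
qed

lemma mult_G_inf [simp]: "\<phi> \<otimes>\<^bsub>G_inf\<^esub> \<psi> = mfps_tuple_compose \<phi> \<psi>"
  by (simp add: G_inf_def)

lemma one_G_inf [simp]: "\<one>\<^bsub>G_inf\<^esub> = (\<chi> i. mfps_var i)"
  by (simp add: G_inf_def)

text \<open>\<open>groupI\<close> asks only for left inverses, so the one-sided construction above
  suffices.\<close>

lemma group_G_inf: "group (G_inf :: (('a::field, 'n::finite) mfps ^ 'n) monoid)"
proof (rule groupI)
  fix \<phi> :: "('a, 'n) mfps ^ 'n"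
  assume \<phi>: "\<phi> \<in> carrier G_inf"
  then obtain \<psi> where \<psi>: "zero_const \<psi>" "mfps_tuple_compose \<psi> \<phi> = (\<chi> i. mfps_var i)"
    by (auto simp: carrier_G_inf elim: mfps_tuple_compose_left_inverse)
  \<comment> \<open>The left inverse lies in the carrier because a one-sided inverse makes a square
    matrix invertible.\<close>
  then have "matrix_of_forms \<psi> ** matrix_of_forms \<phi> = mat 1"
    using \<phi> by (metis carrier_G_inf matrix_of_forms_compose matrix_of_forms_id)
  then have "invertible (matrix_of_forms \<psi>)"
    by (simp add: invertible_right_inverse) blast
  with \<psi> show "\<exists>\<psi>\<in>carrier G_inf. \<psi> \<otimes>\<^bsub>G_inf\<^esub> \<phi> = \<one>\<^bsub>G_inf\<^esub>"
    by (auto simp: carrier_G_inf)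
next
  fix \<phi> :: "('a, 'n) mfps ^ 'n"
  assume "\<phi> \<in> carrier G_inf"
  then show "\<one>\<^bsub>G_inf\<^esub> \<otimes>\<^bsub>G_inf\<^esub> \<phi> = \<phi>"
    by (simp add: carrier_G_inf mfps_tuple_compose_def mfps_compose_var vec_eq_iff)
next
  show "\<one>\<^bsub>G_inf\<^esub> \<in> carrier (G_inf :: (('a, 'n) mfps ^ 'n) monoid)"
    by (simp add: carrier_G_inf invertible_def exI[of _ "mat 1"])
qed (auto simp: carrier_G_inf zero_const_tuple_compose matrix_of_forms_compose invertible_mult
      mfps_tuple_compose_assoc)

section \<open>Composition with averages, and powers of the linear part\<close>

lemma mfps_tuple_compose_sum_left:
  "mfps_tuple_compose (\<chi> i. \<Sum>k\<in>A. mfps_smult c (F k $ i)) \<phi>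
    = (\<chi> i. \<Sum>k\<in>A. mfps_smult c (mfps_tuple_compose (F k) \<phi> $ i))"
  by (simp add: mfps_tuple_compose_def mfps_compose_sum mfps_compose_smult vec_eq_iff)

text \<open>A left factor made of linear forms merely combines components linearly, so it passes
  through sums and scalars in the right argument.\<close>

lemma linear_forms_compose_sum_right:
  assumes "\<And>k. k \<in> A \<Longrightarrow> zero_const (F k)"
  shows "mfps_tuple_compose (linear_forms B) (\<chi> i. \<Sum>k\<in>A. mfps_smult c (F k $ i))
    = (\<chi> i. \<Sum>k\<in>A. mfps_smult c (mfps_tuple_compose (linear_forms B) (F k) $ i))"
proof -
  have "zero_const (\<chi> i. \<Sum>k\<in>A. mfps_smult c (F k $ i))"
    using assms by (simp add: zero_const_def)
  then have "mfps_tuple_compose (linear_forms B) (\<chi> i. \<Sum>k\<in>A. mfps_smult c (F k $ i))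
      = (\<chi> i. \<Sum>j\<in>UNIV. mfps_smult (B $ i $ j) (\<Sum>k\<in>A. mfps_smult c (F k $ j)))"
    by (simp add: linear_forms_compose)
  also have "\<dots> = (\<chi> i. \<Sum>k\<in>A. mfps_smult c (\<Sum>j\<in>UNIV. mfps_smult (B $ i $ j) (F k $ j)))"
    by (simp add: vec_eq_iff mfps_eq_iff sum_distrib_left mult_ac sum.swap[of _ A])
  also have "\<dots> = (\<chi> i. \<Sum>k\<in>A. mfps_smult c (mfps_tuple_compose (linear_forms B) (F k) $ i))"
    using assms by (simp add: linear_forms_compose)
  finally show ?thesis .
qed

text \<open>Both \<open>matrix_of_forms\<close> and \<open>linear_forms\<close> respect products.
  Hence a power of \<phi> equal to the identity forces the same power of its linear part to be the
  identity.\<close>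

lemma homogeneous_part_1_pow:
  fixes \<phi> :: "('a::field, 'n::finite) mfps ^ 'n"
  assumes "\<phi> \<in> carrier G_inf"
  shows "homogeneous_part 1 \<phi> [^]\<^bsub>G_inf\<^esub> (k::nat) = linear_forms (matrix_of_forms (\<phi> [^]\<^bsub>G_inf\<^esub> k))"
proof (induction k)
  case 0
  then show ?case
    by (simp add: linear_forms_mat_1)
next
  case (Suc k)
  have "\<phi> [^]\<^bsub>G_inf\<^esub> k \<in> carrier G_inf"
    using assms by (intro monoid.nat_pow_closed group.is_monoid group_G_inf)
  with Suc assms show ?case
    by (simp add: carrier_G_inf homogeneous_part_1_eq linear_forms_mult matrix_of_forms_compose
        del: One_nat_def)
qed

theorem theorem2:
  fixes \<phi> :: "('a::field, 'n::finite) mfps ^ 'n" and m :: nat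
  assumes "m \<ge> 2"
    and "\<not> CHAR('a) dvd m"
    and "\<phi> \<in> carrier G_inf"
    and "group.ord G_inf \<phi> = m"
    and "diagonalizable (matrix_of_forms (homogeneous_part 1 \<phi>))"
  shows "\<exists>\<psi>\<in>carrier G_inf.
    \<phi> = inv\<^bsub>G_inf\<^esub> \<psi> \<otimes>\<^bsub>G_inf\<^esub> homogeneous_part 1 \<phi> \<otimes>\<^bsub>G_inf\<^esub> \<psi>"
proof -
  let ?G = "G_inf :: (('a, 'n) mfps ^ 'n) monoid"
  interpret group ?G
    by (rule group_G_inf)
  define L where "L = homogeneous_part 1 \<phi>"
  have L_lin: "L = linear_forms (matrix_of_forms \<phi>)"
    unfolding L_def by (rule homogeneous_part_1_eq)
  have L: "L \<in> carrier ?G"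
    using assms(3) by (simp add: L_lin carrier_G_inf)
  have L_pow: "L [^]\<^bsub>?G\<^esub> k = linear_forms (matrix_of_forms (\<phi> [^]\<^bsub>?G\<^esub> k))" for k :: nat
    using homogeneous_part_1_pow[OF assms(3)] by (simp add: L_def)
  have \<phi>_m: "\<phi> [^]\<^bsub>?G\<^esub> m = \<one>\<^bsub>?G\<^esub>"
    using pow_ord_eq_1[OF assms(3)] assms(4) by simp
  have L_m: "L [^]\<^bsub>?G\<^esub> m = \<one>\<^bsub>?G\<^esub>"
    by (simp add: L_pow \<phi>_m linear_forms_mat_1)
  \<comment> \<open>Since the \<open>m\<close>-th power of \<open>L\<close> is the identity, the
    exponent \<open>m - k\<close> stands for \<open>-k\<close> while staying a natural
    number.\<close>
  define F where "F k = L [^]\<^bsub>?G\<^esub> (m - k) \<otimes>\<^bsub>?G\<^esub> \<phi> [^]\<^bsub>?G\<^esub> k" for k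
  have F: "F k \<in> carrier ?G" for k
    using L assms(3) by (simp add: F_def del: mult_G_inf)
  \<comment> \<open>Both values are the identity; this closes the cycle for the index shift
    below.\<close>
  have F_0: "F 0 = F m"
    using L assms(3) \<phi>_m L_m by (simp add: F_def del: mult_G_inf one_G_inf)
  \<comment> \<open>Only linear parts count here, so \<open>L\<close> can be traded for \<phi>,
    which leaves the \<open>m\<close>-th power of \<phi>.\<close>
  have F_lin: "matrix_of_forms (F k) = mat 1" if "k \<le> m" for k
  proof -
    have "matrix_of_forms (F k)
        = matrix_of_forms (\<phi> [^]\<^bsub>?G\<^esub> (m - k)) ** matrix_of_forms (\<phi> [^]\<^bsub>?G\<^esub> k)"
      using nat_pow_closed[OF assms(3), of k]
      by (simp add: F_def L_pow matrix_of_forms_compose carrier_G_inf)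
    also have "\<dots> = matrix_of_forms (\<phi> [^]\<^bsub>?G\<^esub> (m - k) \<otimes>\<^bsub>?G\<^esub> \<phi> [^]\<^bsub>?G\<^esub> k)"
      using nat_pow_closed[OF assms(3)] by (simp add: matrix_of_forms_compose carrier_G_inf)
    also have "\<phi> [^]\<^bsub>?G\<^esub> (m - k) \<otimes>\<^bsub>?G\<^esub> \<phi> [^]\<^bsub>?G\<^esub> k = \<one>\<^bsub>?G\<^esub>"
      using that assms(3) \<phi>_m by (simp add: nat_pow_mult del: mult_G_inf one_G_inf)
    finally show ?thesis
      by simp
  qed
  \<comment> \<open>The new factor \<open>L\<close> raises the exponent \<open>m - Suc k\<close> to
    \<open>m - k\<close>, by \<open>k < m\<close>, while one factor \<phi> splits off on the
    right.\<close>
  have F_shift: "L \<otimes>\<^bsub>?G\<^esub> F (Suc k) = F k \<otimes>\<^bsub>?G\<^esub> \<phi>" if "k < m" for k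
  proof -
    have "L [^]\<^bsub>?G\<^esub> (m - k) = L \<otimes>\<^bsub>?G\<^esub> L [^]\<^bsub>?G\<^esub> (m - Suc k)"
      using nat_pow_Suc2[OF L, of "m - Suc k"] that by (simp add: Suc_diff_Suc del: mult_G_inf)
    then show ?thesis
      using L assms(3) by (simp add: F_def m_assoc del: mult_G_inf)
  qed
  \<comment> \<open>As the characteristic does not divide \<open>m\<close>, the image of
    \<open>m\<close> in the field is nonzero and the average can be formed.\<close>
  define c where "c = (1 :: 'a) / of_nat m"
  have c: "of_nat m * c = 1"
    using assms(2) by (simp add: c_def of_nat_eq_0_iff_char_dvd)
  define \<psi> where "\<psi> = (\<chi> i. \<Sum>k<m. mfps_smult c (F k $ i))"
  have "matrix_of_forms \<psi> $ i $ j = mat 1 $ i $ j" for i j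
  proof -
    have "matrix_of_forms \<psi> $ i $ j = (\<Sum>k<m. c * matrix_of_forms (F k) $ i $ j)"
      by (simp add: \<psi>_def matrix_of_forms_nth)
    also have "\<dots> = (of_nat m * c) * mat 1 $ i $ j"
      by (simp add: F_lin)
    finally show ?thesis
      by (simp add: c)
  qed
  then have "matrix_of_forms \<psi> = mat 1"
    by (simp add: vec_eq_iff)
  moreover have "zero_const \<psi>"
    using F by (simp add: \<psi>_def carrier_G_inf zero_const_def)
  ultimately have \<psi>: "\<psi> \<in> carrier ?G"
    by (simp add: carrier_G_inf invertible_def exI[of _ "mat 1"])
  have "L \<otimes>\<^bsub>?G\<^esub> \<psi> = (\<chi> i. \<Sum>k<m. mfps_smult c ((L \<otimes>\<^bsub>?G\<^esub> F k) $ i))"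
    using F by (simp add: \<psi>_def L_lin linear_forms_compose_sum_right carrier_G_inf)
  also have "\<dots> = (\<chi> i. \<Sum>k<m. mfps_smult c ((L \<otimes>\<^bsub>?G\<^esub> F (Suc k)) $ i))"
  proof -
    \<comment> \<open>Shifting the range drops the term at 0 and gains the one at \<open>m\<close>,
      and these agree.\<close>
    have "sum g {..<m} = (\<Sum>k<m. g (Suc k))" if "g 0 = g m" for g :: "nat \<Rightarrow> ('a, 'n) mfps"
      using sum.lessThan_Suc_shift[of g m] sum.lessThan_Suc[of g m] that by (simp add: add.commute)
    then show ?thesis
      by (simp add: vec_eq_iff F_0 del: mult_G_inf)
  qed
  also have "\<dots> = (\<chi> i. \<Sum>k<m. mfps_smult c ((F k \<otimes>\<^bsub>?G\<^esub> \<phi>) $ i))"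
    by (simp add: F_shift del: mult_G_inf)
  also have "\<dots> = \<psi> \<otimes>\<^bsub>?G\<^esub> \<phi>"
    by (simp add: \<psi>_def mfps_tuple_compose_sum_left)
  finally have conj: "L \<otimes>\<^bsub>?G\<^esub> \<psi> = \<psi> \<otimes>\<^bsub>?G\<^esub> \<phi>" .
  have "inv\<^bsub>?G\<^esub> \<psi> \<otimes>\<^bsub>?G\<^esub> L \<otimes>\<^bsub>?G\<^esub> \<psi> = inv\<^bsub>?G\<^esub> \<psi> \<otimes>\<^bsub>?G\<^esub> (\<psi> \<otimes>\<^bsub>?G\<^esub> \<phi>)"
    using \<psi> L assms(3) by (simp add: m_assoc conj del: mult_G_inf)
  also have "\<dots> = \<phi>"
    using \<psi> assms(3) by (simp add: m_assoc[symmetric] del: mult_G_inf one_G_inf)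
  finally show ?thesis
    using \<psi> unfolding L_def by metis
qed

end
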